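(* Let $X$ be a set, $Y$ a finite set, and $\mathcal{H}$ a non-empty set of functions $X\to 2^Y$ such that for every $h\in\mathcal{H}$ there is $x\in X$ with $h(x)\neq\emptyset$. For any $N\in\mathbb{N}$, if there exists an ambiguous shattered $\mathcal{H}$-tree $T$ with $\mathrm{rank}(T)\ge N^2$, then there exists an ambiguous shattered $\mathcal{H}$-tree $T'$ with $\mathrm{rank}(T')\ge N$ and $\mathrm{dep}(T')\le N^2$.
   Context: $0\in\mathbb{N}$. A rooted tree is $(V,v_0,P)$ with $V$ a finite set, $v_0\in V$ (root), and $P:V\setminus\{v_0\}\to V$ (parent) such that for each $v\in V$ there is $k\in\mathbb{N}$ with $P^k(v)=v_0$. Write $E:=V\setminus\{v_0\}$, $V_f:=V\setminus P(E)$ (leaves), $V_p:=V\setminus V_f$, and $P^*(v):=\{v,P(v),P^2(v),\dots\}$. The depth is $\mathrm{dep}(T):=\max_{u\in V_f}|P^*(u)|-1$. An ambiguous shattered $\mathcal{H}$-tree is $T=(V,v_0,P,\mathbf{x},\mathbf{y},\mathbf{h},E_0)$ with $(V,v_0,P)$ a rooted tree, $\mathbf{x}:V_p\to X$, $\mathbf{y}:E\to Y$, $\mathbf{h}:V_f\to\mathcal{H}$ (written with subscripts) and $E_0\subseteq E$ such that: (i) for every $v\in V_p$, $|P^{-1}(v)\cap E_0|=1$; (ii) if $a\neq b$ in $E$ and $P(a)=P(b)$ then $\mathbf{y}_a\neq\mathbf{y}_b$; (iii) for every $u\in V_f$ and $a\in P^*(u)\setminus\{v_0\}$, $\mathbf{y}_a\in\mathbf{h}_u(\mathbf{x}_{P(a)})$.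 For $u\in V_f$, $R_T(u)$ is the set of $a\in P^*(u)\setminus\{v_0\}$ such that either $a\notin E_0$ or there is $b\in P^{-1}(P(a))$ with $\mathbf{y}_b\notin\mathbf{h}_u(\mathbf{x}_{P(a)})$. The rank is $\mathrm{rank}(T):=\min_{u\in V_f}|R_T(u)|$. *)

theory Defs
  imports Main "HOL-Library.FuncSet"
begin

text \<open>
  Partial maps defined on a set of vertices are total functions here; their values outside the
  intended domain are irrelevant and never used. In particular the parent of the root is
  arbitrary, so iteration of the parent map has to be stopped at the root explicitly.
\<close>

record 'v rooted_tree =
  verts :: "'v set"
  root :: 'v
  parent :: "'v \<Rightarrow> 'v"

definition edges :: "('v, 'm) rooted_tree_scheme \<Rightarrow> 'v set" where
  "edges T = verts T - {root T}"

text \<open>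
  The number \<open>k\<close> below can be taken least, and then all parents involved are
  parents of non-root vertices.
\<close>

definition is_rooted_tree :: "('v, 'm) rooted_tree_scheme \<Rightarrow> bool" where
  "is_rooted_tree T \<longleftrightarrow>
     finite (verts T) \<and> root T \<in> verts T \<and> parent T \<in> edges T \<rightarrow> verts T \<and>
     (\<forall>v \<in> verts T. \<exists>k. (parent T ^^ k) v = root T)"

definition children :: "('v, 'm) rooted_tree_scheme \<Rightarrow> 'v \<Rightarrow> 'v set" where
  "children T v = {a \<in> edges T. parent T a = v}"

definition leaves :: "('v, 'm) rooted_tree_scheme \<Rightarrow> 'v set" where
  "leaves T = verts T - parent T ` edges T"

definition inner_verts :: "('v, 'm) rooted_tree_scheme \<Rightarrow> 'v set" where
  "inner_verts T = verts T - leaves T"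

definition ancestors :: "('v, 'm) rooted_tree_scheme \<Rightarrow> 'v \<Rightarrow> 'v set" where
  "ancestors T v = {(parent T ^^ k) v | k. \<forall>j<k. (parent T ^^ j) v \<noteq> root T}"

text \<open>
  In a rooted tree the set of leaves is finite and non-empty, so the \<open>Max\<close> and \<open>Min\<close> below are
  genuine, and each vertex is its own ancestor, so the subtraction does not truncate.
\<close>

definition depth :: "('v, 'm) rooted_tree_scheme \<Rightarrow> nat" where
  "depth T = Max ((\<lambda>u. card (ancestors T u)) ` leaves T) - 1"

record ('v, 'x, 'y) hyp_tree = "'v rooted_tree" +
  xlab :: "'v \<Rightarrow> 'x"
  ylab :: "'v \<Rightarrow> 'y"
  hlab :: "'v \<Rightarrow> ('x \<Rightarrow> 'y set)"
  edges0 :: "'v set"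

definition ambiguous_shattered ::
  "'x set \<Rightarrow> 'y set \<Rightarrow> ('x \<Rightarrow> 'y set) set \<Rightarrow> ('v, 'x, 'y) hyp_tree \<Rightarrow> bool" where
  "ambiguous_shattered X Y H T \<longleftrightarrow>
     is_rooted_tree T \<and>
     xlab T \<in> inner_verts T \<rightarrow> X \<and>
     ylab T \<in> edges T \<rightarrow> Y \<and>
     hlab T \<in> leaves T \<rightarrow> H \<and>
     edges0 T \<subseteq> edges T \<and>
     (\<forall>v \<in> inner_verts T. card (children T v \<inter> edges0 T) = 1) \<and>
     (\<forall>a \<in> edges T. \<forall>b \<in> edges T.
        a \<noteq> b \<and> parent T a = parent T b \<longrightarrow> ylab T a \<noteq> ylab T b) \<and>
     (\<forall>u \<in> leaves T. \<forall>a \<in> ancestors T u - {root T}.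
        ylab T a \<in> hlab T u (xlab T (parent T a)))"

definition rank_set :: "('v, 'x, 'y) hyp_tree \<Rightarrow> 'v \<Rightarrow> 'v set" where
  "rank_set T u = {a \<in> ancestors T u - {root T}.
     a \<notin> edges0 T \<or>
     (\<exists>b \<in> children T (parent T a). ylab T b \<notin> hlab T u (xlab T (parent T a)))}"

definition rank :: "('v, 'x, 'y) hyp_tree \<Rightarrow> nat" where
  "rank T = Min ((\<lambda>u. card (rank_set T u)) ` leaves T)"

end

theory Submission
  imports Defs "HOL-Library.Nat_Bijection"
begin

text \<open>
  Read the tree as a game: a position consists of the set \<open>S\<close> of hypotheses consistent with the
  labels chosen so far, and of the number \<open>w h\<close> of rank edges met so far from the point of view of
  each hypothesis \<open>h\<close>. Walk from the root along the edges in \<open>E\<^sub>0\<close> up to the first vertex below which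
  some hypothesis \<open>g\<close> has been charged \<open>N\<close> times. Keep only the \<open>N\<close> vertices of this path at which
  \<open>g\<close> was charged, and put a leaf labelled \<open>g\<close> at the end. Before that point every hypothesis has been
  charged less than \<open>N\<close> times, so the subtree below an edge leaving the path still has rank at least
  \<open>N\<^sup>2 - N \<ge> (N - 1)\<^sup>2\<close>; by induction it can be replaced by one of rank \<open>N - 1\<close> and depth
  \<open>(N - 1)\<^sup>2\<close>, and the leaving edge itself contributes the missing unit of rank.
\<close>

section \<open>Rooted trees\<close>

lemma ancestors_root: "ancestors T (root T) = {root T}"
proof -
  have "k = 0" if "\<forall>j<k. (parent T ^^ j) (root T) \<noteq> root T" for k
    using that by (cases k) (auto dest: spec[of _ 0])
  then show ?thesis
    unfolding ancestors_def by (force intro: exI[of _ 0])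
qed

lemma ancestors_step:
  assumes "v \<noteq> root T"
  shows "ancestors T v = insert v (ancestors T (parent T v))"
proof (intro equalityI subsetI)
  fix a assume "a \<in> ancestors T v"
  then obtain k where k: "a = (parent T ^^ k) v" "\<forall>j<k. (parent T ^^ j) v \<noteq> root T"
    unfolding ancestors_def by blast
  show "a \<in> insert v (ancestors T (parent T v))"
  proof (cases k)
    case 0
    then show ?thesis using k by simp
  next
    case (Suc m)
    have "a = (parent T ^^ m) (parent T v)"
      using k(1) Suc by (simp add: funpow_swap1)
    moreover have "(parent T ^^ j) (parent T v) \<noteq> root T" if "j < m" for j
      using k(2)[rule_format, of "Suc j"] that Suc by (simp add: funpow_swap1)
    ultimately show ?thesis
      unfolding ancestors_def by blast
  qed
next
  fix a assume "a \<in> insert v (ancestors T (parent T v))"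
  then consider "a = v" | "a \<in> ancestors T (parent T v)" by blast
  then show "a \<in> ancestors T v"
  proof cases
    case 1
    then show ?thesis
      unfolding ancestors_def by (auto intro: exI[of _ 0])
  next
    case 2
    then obtain k where k: "a = (parent T ^^ k) (parent T v)"
        "\<forall>j<k. (parent T ^^ j) (parent T v) \<noteq> root T"
      unfolding ancestors_def by blast
    have "a = (parent T ^^ Suc k) v"
      using k(1) by (simp add: funpow_swap1)
    moreover have "(parent T ^^ j) v \<noteq> root T" if "j < Suc k" for j
      using k(2) that assms by (cases j) (auto simp: funpow_swap1)
    ultimately show ?thesis
      unfolding ancestors_def by blast
  qed
qed

lemma ancestors_self: "v \<in> ancestors T v"
  by (cases "v = root T") (simp_all add: ancestors_root ancestors_step)

lemma parent_in_verts: "is_rooted_tree T \<Longrightarrow> v \<in> edges T \<Longrightarrow> parent T v \<in> verts T"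
  unfolding is_rooted_tree_def by blast

text \<open>Induction on the number of parent steps that lead to the root; it replaces reasoning
  about iterates in what follows.\<close>

lemma rooted_tree_induct [consumes 2, case_names root edge]:
  assumes T: "is_rooted_tree T" and "v \<in> verts T"
    and root: "P (root T)"
    and edge: "\<And>v. v \<in> edges T \<Longrightarrow> P (parent T v) \<Longrightarrow> P v"
  shows "P v"
proof -
  obtain k where "(parent T ^^ k) v = root T"
    using assms unfolding is_rooted_tree_def by blast
  with \<open>v \<in> verts T\<close> show ?thesis
  proof (induction k arbitrary: v)
    case 0
    then show ?case using root by simp
  next
    case (Suc k)
    show ?case
    \<comment> \<open>The parent of the root is arbitrary, so the root has to be split off for every
      \<open>k\<close>, not only for \<open>k = 0\<close>.\<close>
    proof (cases "v = root T")
      case False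
      then have "v \<in> edges T" using Suc by (simp add: edges_def)
      then show ?thesis
        using Suc edge parent_in_verts[OF T] by (simp add: funpow_swap1)
    qed (use root in simp)
  qed
qed

lemma ancestors_subset_verts:
  assumes "is_rooted_tree T" "v \<in> verts T"
  shows "ancestors T v \<subseteq> verts T"
  using assms
proof (induction rule: rooted_tree_induct)
  case root
  then show ?case using assms by (simp add: ancestors_root is_rooted_tree_def)
next
  case (edge v)
  then show ?case by (simp add: ancestors_step edges_def)
qed

lemma finite_ancestors: "is_rooted_tree T \<Longrightarrow> v \<in> verts T \<Longrightarrow> finite (ancestors T v)"
  by (rule finite_subset[OF ancestors_subset_verts]) (simp_all add: is_rooted_tree_def)

text \<open>Otherwise \<open>v\<close> would be periodic under the parent map, with an orbit that
  avoids the root, although some iterate of \<open>v\<close> is the root. Hence each edge adds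
  exactly one ancestor.\<close>

lemma not_ancestor_parent:
  assumes T: "is_rooted_tree T" and v: "v \<in> edges T"
  shows "v \<notin> ancestors T (parent T v)"
proof
  assume "v \<in> ancestors T (parent T v)"
  then obtain k where k: "v = (parent T ^^ k) (parent T v)"
      "\<forall>j<k. (parent T ^^ j) (parent T v) \<noteq> root T"
    unfolding ancestors_def by blast
  have per: "(parent T ^^ Suc k) v = v"
    using k(1) by (simp add: funpow_swap1)
  have ne: "(parent T ^^ j) v \<noteq> root T" if "j < Suc k" for j
    using k(2) that v by (cases j) (auto simp: funpow_swap1 edges_def)
  obtain n where "(parent T ^^ n) v = root T"
    using T v unfolding is_rooted_tree_def edges_def by blast
  moreover have "(parent T ^^ (n mod Suc k)) v = (parent T ^^ n) v"
    by (rule funpow_mod_eq[OF per])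
  ultimately show False using ne[of "n mod Suc k"] by simp
qed

lemma leaf_iff: "v \<in> leaves T \<longleftrightarrow> v \<in> verts T \<and> children T v = {}"
  unfolding leaves_def children_def by auto

lemma root_notin_children: "root T \<notin> children T v"
  by (simp add: children_def edges_def)

lemma leaf_in_verts: "u \<in> leaves T \<Longrightarrow> u \<in> verts T"
  by (simp add: leaves_def)

lemma inner_vert_iff: "v \<in> inner_verts T \<longleftrightarrow> v \<in> verts T \<and> children T v \<noteq> {}"
  unfolding inner_verts_def by (auto simp: leaf_iff)

lemma finite_leaves: "is_rooted_tree T \<Longrightarrow> finite (leaves T)"
  by (simp add: is_rooted_tree_def leaves_def)

lemma finite_children: "is_rooted_tree T \<Longrightarrow> finite (children T v)"
  by (simp add: is_rooted_tree_def children_def edges_def)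

text \<open>A vertex with the most ancestors is a leaf, since a child would have one ancestor
  more.\<close>

lemma leaves_nonempty:
  assumes T: "is_rooted_tree T"
  shows "leaves T \<noteq> {}"
proof -
  let ?A = "(\<lambda>v. card (ancestors T v)) ` verts T"
  have fin: "finite ?A" and "?A \<noteq> {}"
    using T unfolding is_rooted_tree_def by auto
  then have "Max ?A \<in> ?A" by (rule Max_in)
  then obtain v where v: "v \<in> verts T" "card (ancestors T v) = Max ?A" by auto
  have "children T v = {}"
  proof (rule ccontr)
    assume "children T v \<noteq> {}"
    then obtain a where a: "a \<in> edges T" "parent T a = v"
      unfolding children_def by blast
    have "card (ancestors T a) = Suc (card (ancestors T v))"
      using not_ancestor_parent[OF T a(1)] finite_ancestors[OF T v(1)] a
      by (simp add: ancestors_step edges_def)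
    moreover have "card (ancestors T a) \<le> Max ?A"
      using fin a by (intro Max_ge) (auto simp: edges_def)
    ultimately show False using v(2) by simp
  qed
  then show ?thesis using v by (auto simp: leaf_iff)
qed

section \<open>The game\<close>

text \<open>A derivation is a shattered tree stripped of its vertices. Siblings carry distinct
  labels, so a child is named by its label: \<open>C\<close> collects the labels, \<open>y0\<close>
  is the one on the \<open>edges0\<close> edge, and \<open>D\<close> bounds the height. The
  \<open>of_bool\<close> term is 1 exactly if the edge labelled \<open>y\<close> counts towards the
  rank at a leaf below it that carries \<open>h\<close>.\<close>

inductive win :: "'x set \<Rightarrow> 'y set \<Rightarrow> nat \<Rightarrow> ('x \<Rightarrow> 'y set) set \<Rightarrow> (('x \<Rightarrow> 'y set) \<Rightarrow> nat) \<Rightarrow> nat \<Rightarrow> bool"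
  for X :: "'x set" and Y :: "'y set" and N :: nat where
  leaf: "h \<in> S \<Longrightarrow> N \<le> w h \<Longrightarrow> win X Y N S w D"
| node: "\<lbrakk>x \<in> X; C \<subseteq> Y; finite C; y0 \<in> C;
    \<And>y. y \<in> C \<Longrightarrow>
      win X Y N {h \<in> S. y \<in> h x} (\<lambda>h. w h + of_bool (y \<noteq> y0 \<or> \<not> C \<subseteq> h x)) D\<rbrakk>
    \<Longrightarrow> win X Y N S w (Suc D)"

text \<open>The same derivation is replayed. Counts matter only at leaves, through the missing
  credit \<open>N - w h\<close>, and leaf labels come from \<open>S\<close>. The additive form of
  the bound avoids truncated subtraction.\<close>

lemma win_mono:
  assumes "win X Y N S w D" and "S \<subseteq> S'" and "\<And>h. h \<in> S \<Longrightarrow> N' + w h \<le> N + w' h" and "D \<le> D'"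
  shows "win X Y N' S' w' D'"
  using assms
proof (induction arbitrary: S' w' D')
  case (leaf h S w D)
  have "N' + w h \<le> N + w' h" using leaf by blast
  with \<open>N \<le> w h\<close> have "N' \<le> w' h" by linarith
  moreover have "h \<in> S'" using leaf by blast
  ultimately show ?case by (rule win.leaf[rotated])
next
  case (node x C y0 S w D)
  obtain E where E: "D' = Suc E" "D \<le> E"
    using node.prems(3) by (cases D') auto
  have "win X Y N' {h \<in> S'. y \<in> h x} (\<lambda>h. w' h + of_bool (y \<noteq> y0 \<or> \<not> C \<subseteq> h x)) E"
    if "y \<in> C" for y
  proof (rule node.IH[OF that])
    show "{h \<in> S. y \<in> h x} \<subseteq> {h \<in> S'. y \<in> h x}" using node.prems(1) by blast
  qed (use node.prems(2) E in auto)
  from win.node[OF node.hyps(1-4) this] show ?case unfolding E(1) .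
qed

text \<open>
  In the conclusion only \<open>g\<close> retains its count: all other hypotheses meet an edge that leaves the path
  and need no earlier credit.
\<close>

lemma win_follow_path:
  assumes "win X Y M S w D"
    and branch: "\<And>S' w' D'. win X Y M S' w' D' \<Longrightarrow> (\<And>h. h \<in> S' \<Longrightarrow> w' h \<le> N)
      \<Longrightarrow> win X Y (N - 1) S' (\<lambda>h. 0) E"
    and "N \<le> M" and "\<And>h. h \<in> S \<Longrightarrow> w h < N"
  shows "\<exists>g\<in>S. win X Y N S (\<lambda>h. if h = g then w g else 0) (N - w g + E)"
  using assms(1,4)
proof (induction)
  case (leaf h S w D)
  \<comment> \<open>No leaf can occur this early: \<open>N \<le> M \<le> w h\<close> contradicts
    \<open>w h < N\<close>.\<close>
  then show ?case using \<open>N \<le> M\<close> by fastforce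
next
  case (node x C y0 S w D)
  let ?w = "\<lambda>y h. w h + of_bool (y \<noteq> y0 \<or> \<not> C \<subseteq> h x) :: nat"
  \<comment> \<open>An edge off the path charges every hypothesis by 1, which lifts the rank
    \<open>N - 1\<close> supplied by \<open>branch\<close> to \<open>N\<close>. Counts there are at
    most \<open>N\<close>, as \<open>branch\<close> demands, because they were below
    \<open>N\<close> one edge earlier.\<close>
  have side: "win X Y N {h \<in> S. y \<in> h x}
      (\<lambda>h. (if h = g then w g else 0) + of_bool (y \<noteq> y0 \<or> \<not> C \<subseteq> h x)) (k + E)"
    if "y \<in> C" "y \<noteq> y0" for y g k
  proof -
    have "?w y h \<le> N" if "h \<in> {h \<in> S. y \<in> h x}" for h
      using node.prems[of h] that by auto
    from branch[OF node.hyps(5)[OF \<open>y \<in> C\<close>] this]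
    have "win X Y (N - 1) {h \<in> S. y \<in> h x} (\<lambda>h. 0) E" .
    then show ?thesis
      by (rule win_mono) (use that in auto)
  qed
  \<comment> \<open>The vertex is kept when \<open>g\<close> is charged on the \<open>y0\<close>
    edge: the derivation \<open>main\<close> continues below that edge, the other edges get their
    \<open>side\<close> branches, and one level of depth pays for one unit of credit.\<close>
  have extend: "win X Y N S (\<lambda>h. if h = g then w g else 0) (N - w g + E)"
    if "g \<in> S" "\<not> C \<subseteq> g x"
      and main: "win X Y N {h \<in> S. y0 \<in> h x} (\<lambda>h. if h = g then ?w y0 g else 0) (N - ?w y0 g + E)"
    for g
  proof -
    have "win X Y N S (\<lambda>h. if h = g then w g else 0) (Suc (N - Suc (w g) + E))"
    proof (rule win.node[OF node.hyps(1-4)])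
      fix y assume "y \<in> C"
      show "win X Y N {h \<in> S. y \<in> h x}
        (\<lambda>h. (if h = g then w g else 0) + of_bool (y \<noteq> y0 \<or> \<not> C \<subseteq> h x)) (N - Suc (w g) + E)"
      proof (cases "y = y0")
        case True
        then show ?thesis
          using that(2) by (intro win_mono[OF main]) auto
      qed (use side \<open>y \<in> C\<close> in blast)
    qed
    \<comment> \<open>Nothing is truncated here because \<open>w g < N\<close>.\<close>
    moreover have "Suc (N - Suc (w g) + E) = N - w g + E"
      using node.prems[OF \<open>g \<in> S\<close>] by simp
    ultimately show ?thesis by (simp only:)
  qed
  \<comment> \<open>Either some hypothesis reaches \<open>N\<close> on the \<open>y0\<close> edge,
    and the path ends there in a leaf labelled by it, or all counts stay below \<open>N\<close> and
    the induction hypothesis supplies \<open>g\<close>.\<close>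
  show ?case
  proof (cases "\<exists>g \<in> {h \<in> S. y0 \<in> h x}. N \<le> ?w y0 g")
    case True
    then obtain g where g: "g \<in> S" "y0 \<in> g x" "N \<le> ?w y0 g" by blast
    then have "\<not> C \<subseteq> g x" using node.prems[of g] by (cases "C \<subseteq> g x") auto
    moreover have "win X Y N {h \<in> S. y0 \<in> h x} (\<lambda>h. if h = g then ?w y0 g else 0) (N - ?w y0 g + E)"
      using g by (intro win.leaf[of g]) auto
    ultimately show ?thesis using extend g(1) by blast
  next
    case False
    then obtain g where g: "g \<in> S" "y0 \<in> g x"
      and main: "win X Y N {h \<in> S. y0 \<in> h x} (\<lambda>h. if h = g then ?w y0 g else 0) (N - ?w y0 g + E)"
      using node.IH[OF \<open>y0 \<in> C\<close>] by (auto simp: not_le)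
    show ?thesis
    proof (cases "C \<subseteq> g x")
      case True
      \<comment> \<open>The vertex does not charge \<open>g\<close>, so it is skipped and the
        derivation below it serves for \<open>S\<close> directly.\<close>
      then have "win X Y N S (\<lambda>h. if h = g then w g else 0) (N - w g + E)"
        by (intro win_mono[OF main]) auto
      then show ?thesis using g(1) by blast
    next
      case False
      then show ?thesis using extend[OF g(1) _ main] g(1) by blast
    qed
  qed
qed

lemma win_nonempty: "win X Y N S w D \<Longrightarrow> S \<noteq> {}"
  by (induction rule: win.induct) auto

lemma win_compress:
  assumes "win X Y (N\<^sup>2) S (\<lambda>h. 0) D"
  shows "win X Y N S (\<lambda>h. 0) (N\<^sup>2)"
  using assms
proof (induction N arbitrary: S D)
  case 0
  then obtain h where "h \<in> S"
    using win_nonempty by blast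
  then show ?case by (rule win.leaf) simp
next
  case (Suc N)
  have "win X Y (Suc N - 1) S' (\<lambda>h. 0) (N\<^sup>2)"
    if win: "win X Y ((Suc N)\<^sup>2) S' w' D'" and le: "\<And>h. h \<in> S' \<Longrightarrow> w' h \<le> Suc N" for S' w' D'
  proof -
    \<comment> \<open>Counts of at most \<open>Suc N\<close> can be forgotten: the remaining demand
      is still at least \<open>N\<^sup>2\<close>.\<close>
    have "N\<^sup>2 + Suc N \<le> (Suc N)\<^sup>2" by (simp add: power2_eq_square)
    then have "win X Y (N\<^sup>2) S' (\<lambda>h. 0) D'"
      by (intro win_mono[OF win]) (use le in fastforce)+
    then show ?thesis using Suc.IH by simp
  qed
  from win_follow_path[OF Suc.prems this]
  obtain g where "win X Y (Suc N) S (\<lambda>h. if h = g then 0 else 0) (Suc N - 0 + N\<^sup>2)"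
    by (auto simp: power2_eq_square)
  \<comment> \<open>At most \<open>Suc N\<close> kept vertices on the path, followed by a branch of
    depth at most \<open>N\<^sup>2\<close>.\<close>
  moreover have "Suc N - 0 + N\<^sup>2 \<le> (Suc N)\<^sup>2" by (simp add: power2_eq_square)
  ultimately show ?case by - (erule win_mono, auto)
qed

section \<open>From trees to the game\<close>

lemma ambiguous_shatteredD:
  assumes "ambiguous_shattered X Y H T"
  shows "is_rooted_tree T"
    and "v \<in> inner_verts T \<Longrightarrow> xlab T v \<in> X"
    and "a \<in> edges T \<Longrightarrow> ylab T a \<in> Y"
    and "u \<in> leaves T \<Longrightarrow> hlab T u \<in> H"
    and "edges0 T \<subseteq> edges T"
    and "v \<in> inner_verts T \<Longrightarrow> card (children T v \<inter> edges0 T) = 1"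
    and "inj_on (ylab T) (children T v)"
    and "u \<in> leaves T \<Longrightarrow> a \<in> ancestors T u - {root T} \<Longrightarrow>
      ylab T a \<in> hlab T u (xlab T (parent T a))"
proof -
  show "inj_on (ylab T) (children T v)"
    using assms unfolding ambiguous_shattered_def inj_on_def children_def by blast
qed (use assms in \<open>simp_all add: ambiguous_shattered_def Pi_iff\<close>)

text \<open>This is \<open>rank_set\<close> with the hypothesis decoupled from the vertex, so that
  counts make sense at inner vertices, before a leaf label is known.\<close>

definition charged :: "('v, 'x, 'y) hyp_tree \<Rightarrow> 'v \<Rightarrow> ('x \<Rightarrow> 'y set) \<Rightarrow> 'v set" where
  "charged T v h = {a \<in> ancestors T v - {root T}. a \<notin> edges0 T \<or>
     (\<exists>b \<in> children T (parent T a). ylab T b \<notin> h (xlab T (parent T a)))}"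

lemma rank_set_eq_charged: "rank_set T u = charged T u (hlab T u)"
  by (simp add: rank_set_def charged_def)

definition consistent :: "('v, 'x, 'y) hyp_tree \<Rightarrow> 'v \<Rightarrow> ('x \<Rightarrow> 'y set) set" where
  "consistent T v = {h. \<forall>a \<in> ancestors T v - {root T}. ylab T a \<in> h (xlab T (parent T a))}"

lemma rank_ge_iff:
  assumes "is_rooted_tree T"
  shows "n \<le> rank T \<longleftrightarrow> (\<forall>u \<in> leaves T. n \<le> card (rank_set T u))"
  unfolding rank_def using assms finite_leaves leaves_nonempty by (subst Min_ge_iff) auto

lemma depth_le_iff:
  assumes "is_rooted_tree T"
  shows "depth T \<le> n \<longleftrightarrow> (\<forall>u \<in> leaves T. card (ancestors T u) \<le> Suc n)"
proof -
  have "depth T \<le> n \<longleftrightarrow> Max ((\<lambda>u. card (ancestors T u)) ` leaves T) \<le> Suc n"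
    unfolding depth_def by linarith
  also have "\<dots> \<longleftrightarrow> (\<forall>u \<in> leaves T. card (ancestors T u) \<le> Suc n)"
    using assms finite_leaves leaves_nonempty by (subst Max_le_iff) auto
  finally show ?thesis .
qed

text \<open>The tree itself is the strategy, read from the leaves upwards. The number of vertices
  that are not ancestors of \<open>v\<close> drops by one with each edge, so it is both the
  induction measure and a height bound.\<close>

lemma win_of_subtree:
  assumes T: "ambiguous_shattered X Y H T" and rank: "N \<le> rank T"
    and "v \<in> verts T"
  shows "win X Y N (H \<inter> consistent T v) (\<lambda>h. card (charged T v h))
    (card (verts T) - card (ancestors T v))"
  using \<open>v \<in> verts T\<close>
proof (induction "card (verts T) - card (ancestors T v)" arbitrary: v rule: less_induct)
  case less
  note tree = ambiguous_shatteredD(1)[OF T]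
  show ?case
  proof (cases "children T v = {}")
    case True
    then have v: "v \<in> leaves T" using less.prems by (simp add: leaf_iff)
    then have "hlab T v \<in> H \<inter> consistent T v"
      using ambiguous_shatteredD(4,8)[OF T] unfolding consistent_def by blast
    moreover have "N \<le> card (charged T v (hlab T v))"
      using rank v rank_ge_iff[OF tree] by (simp add: rank_set_eq_charged)
    ultimately show ?thesis by (rule win.leaf)
  next
    case False
    then have v: "v \<in> inner_verts T" using less.prems by (simp add: inner_vert_iff)
    let ?x = "xlab T v" and ?C = "ylab T ` children T v"
    have x: "?x \<in> X" and C: "?C \<subseteq> Y"
      using ambiguous_shatteredD(2,3)[OF T] v unfolding children_def by blast+
    note inj = ambiguous_shatteredD(7)[OF T, of v]
    obtain a0 where a0: "children T v \<inter> edges0 T = {a0}"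
      using ambiguous_shatteredD(6)[OF T v] by (rule card_1_singletonE)
    let ?E = "card (verts T) - Suc (card (ancestors T v))"
    have child: "card (ancestors T a) = Suc (card (ancestors T v))"
      "Suc (card (ancestors T v)) \<le> card (verts T)"
      if "a \<in> children T v" for a
    proof -
      have a: "a \<in> edges T" "parent T a = v" "a \<in> verts T"
        using that unfolding children_def edges_def by auto
      show *: "card (ancestors T a) = Suc (card (ancestors T v))"
        using not_ancestor_parent[OF tree a(1)] finite_ancestors[OF tree less.prems] a
        by (simp add: ancestors_step edges_def)
      show "Suc (card (ancestors T v)) \<le> card (verts T)"
        unfolding *[symmetric] using ancestors_subset_verts[OF tree a(3)] tree
        by (intro card_mono) (auto simp: is_rooted_tree_def)
    qed
    \<comment> \<open>\<open>v\<close> has a child, hence a vertex outside its ancestors, so the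
      subtraction in \<open>?E\<close> is exact.\<close>
    have D: "card (verts T) - card (ancestors T v) = Suc ?E"
      using child(2) False by fastforce
    show ?thesis unfolding D
    proof (rule win.node[OF x C])
      show "finite ?C" using finite_children[OF tree] by blast
      show "ylab T a0 \<in> ?C" using a0 by blast
      fix y assume "y \<in> ?C"
      then obtain a where a: "a \<in> children T v" "y = ylab T a" by blast
      then have a': "a \<noteq> root T" "parent T a = v" "a \<in> verts T" "a \<in> edges T"
        unfolding children_def edges_def by auto
      have charged: "charged T a h = charged T v h \<union>
          (if y \<noteq> ylab T a0 \<or> \<not> ?C \<subseteq> h ?x then {a} else {})" for h
      proof -
        \<comment> \<open>Since sibling labels are distinct, membership in \<open>edges0\<close> can
          be read off the label.\<close>
        have "a \<in> edges0 T \<longleftrightarrow> a = a0"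
          using a a0 by blast
        also have "\<dots> \<longleftrightarrow> y = ylab T a0"
          using inj_on_eq_iff[OF inj] a a0 by blast
        finally have "a \<in> edges0 T \<longleftrightarrow> y = ylab T a0" .
        moreover have "(\<exists>b \<in> children T v. ylab T b \<notin> h ?x) \<longleftrightarrow> \<not> ?C \<subseteq> h ?x"
          by blast
        ultimately show ?thesis
          unfolding charged_def using a' by (auto simp: ancestors_step)
      qed
      have "a \<notin> charged T v h" "finite (charged T v h)" for h
        using not_ancestor_parent[OF tree a'(4)] a'(2) finite_ancestors[OF tree less.prems]
        by (auto simp: charged_def)
      then have "card (charged T a h) =
          card (charged T v h) + of_bool (y \<noteq> ylab T a0 \<or> \<not> ?C \<subseteq> h ?x)" for h
        unfolding charged by simp
      moreover have "H \<inter> consistent T a = {h \<in> H \<inter> consistent T v. y \<in> h ?x}"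
        unfolding consistent_def using a a' by (auto simp: ancestors_step)
      moreover have "win X Y N (H \<inter> consistent T a) (\<lambda>h. card (charged T a h))
          (card (verts T) - card (ancestors T a))"
        by (rule less.hyps) (use child[OF a(1)] a' in auto)
      ultimately show "win X Y N {h \<in> H \<inter> consistent T v. y \<in> h ?x}
          (\<lambda>h. card (charged T v h) + of_bool (y \<noteq> ylab T a0 \<or> \<not> ?C \<subseteq> h ?x)) ?E"
        using child[OF a(1)] by simp
    qed
  qed
qed

lemma win_of_tree:
  assumes T: "ambiguous_shattered X Y H T" and "N \<le> rank T"
  shows "\<exists>D. win X Y N H (\<lambda>h. 0) D"
proof -
  have "root T \<in> verts T"
    using ambiguous_shatteredD(1)[OF T] by (simp add: is_rooted_tree_def)
  from win_of_subtree[OF assms this]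
  have "win X Y N H (\<lambda>h. 0) (card (verts T) - 1)"
    by (simp add: consistent_def charged_def ancestors_root)
  then show ?thesis by blast
qed

section \<open>From the game to trees\<close>

text \<open>Realises a game node as a tree: a new root with instance \<open>x\<close>, below which
  the root of \<open>T y\<close> hangs on an edge labelled \<open>y\<close>, for each
  \<open>y\<close> in \<open>C\<close>.\<close>

locale glue =
  fixes code :: "'y \<Rightarrow> nat" and x :: 'x and C :: "'y set" and y0 :: 'y
    and T :: "'y \<Rightarrow> (nat, 'x, 'y) hyp_tree"
  assumes inj_code: "inj_on code C" and finite_C: "finite C" and y0: "y0 \<in> C"
    and trees: "\<And>y. y \<in> C \<Longrightarrow> is_rooted_tree (T y)"
begin

text \<open>Tagging with \<open>code y\<close> makes the copies disjoint, and \<open>Suc\<close>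
  reserves 0 for the new root.\<close>

definition emb :: "'y \<Rightarrow> nat \<Rightarrow> nat" where
  "emb y v = Suc (prod_encode (code y, v))"

definition branch :: "nat \<Rightarrow> 'y" where
  "branch n = inv_into C code (fst (prod_decode (n - 1)))"

definition local_vert :: "nat \<Rightarrow> nat" where
  "local_vert n = snd (prod_decode (n - 1))"

text \<open>An edge is named by its lower endpoint, so the old roots become the edges at the new
  root, and only that of \<open>T y0\<close> is added to \<open>edges0\<close>.\<close>

definition G :: "(nat, 'x, 'y) hyp_tree" where
  "G = \<lparr>verts = insert 0 (\<Union>y\<in>C. emb y ` verts (T y)),
    root = 0,
    parent = (\<lambda>n. let y = branch n; v = local_vert n in
      if v = root (T y) then 0 else emb y (parent (T y) v)),
    xlab = (\<lambda>n. if n = 0 then x else xlab (T (branch n)) (local_vert n)),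
    ylab = (\<lambda>n. let y = branch n; v = local_vert n in
      if v = root (T y) then y else ylab (T y) v),
    hlab = (\<lambda>n. hlab (T (branch n)) (local_vert n)),
    edges0 = insert (emb y0 (root (T y0))) (\<Union>y\<in>C. emb y ` edges0 (T y))\<rparr>"

lemma branch_emb [simp]: "y \<in> C \<Longrightarrow> branch (emb y v) = y"
  by (simp add: branch_def emb_def inj_code)

lemma local_vert_emb [simp]: "local_vert (emb y v) = v"
  by (simp add: local_vert_def emb_def)

lemma emb_neq_0 [simp]: "emb y v \<noteq> 0" "0 \<noteq> emb y v"
  by (simp_all add: emb_def)

lemma emb_eq_iff [simp]:
  "y \<in> C \<Longrightarrow> y' \<in> C \<Longrightarrow> emb y v = emb y' v' \<longleftrightarrow> y = y' \<and> v = v'"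
  by (metis branch_emb local_vert_emb)

lemma emb_in_image_iff [simp]:
  "y \<in> C \<Longrightarrow> z \<in> C \<Longrightarrow> emb z v \<in> emb y ` A \<longleftrightarrow> z = y \<and> v \<in> A"
  by auto

lemma inj_emb: "inj_on (emb y) A"
  by (metis inj_onI local_vert_emb)

lemma root_G [simp]: "root G = 0"
  by (simp add: G_def)

lemma verts_G: "verts G = insert 0 (\<Union>y\<in>C. emb y ` verts (T y))"
  by (simp add: G_def)

lemma edges0_G: "edges0 G = insert (emb y0 (root (T y0))) (\<Union>y\<in>C. emb y ` edges0 (T y))"
  by (simp add: G_def)

lemma parent_G_emb [simp]:
  "y \<in> C \<Longrightarrow> parent G (emb y v) = (if v = root (T y) then 0 else emb y (parent (T y) v))"
  by (simp add: G_def)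

lemma xlab_G_0 [simp]: "xlab G 0 = x"
  by (simp add: G_def)

lemma xlab_G_emb [simp]: "y \<in> C \<Longrightarrow> xlab G (emb y v) = xlab (T y) v"
  by (simp add: G_def)

lemma ylab_G_emb [simp]:
  "y \<in> C \<Longrightarrow> ylab G (emb y v) = (if v = root (T y) then y else ylab (T y) v)"
  by (simp add: G_def)

lemma hlab_G_emb [simp]: "y \<in> C \<Longrightarrow> hlab G (emb y v) = hlab (T y) v"
  by (simp add: G_def)

lemma edges_G: "edges G = (\<Union>y\<in>C. emb y ` verts (T y))"
  unfolding edges_def verts_G by auto

lemma root_T: "y \<in> C \<Longrightarrow> root (T y) \<in> verts (T y)"
  using trees unfolding is_rooted_tree_def by blast

lemma verts_T_iff: "y \<in> C \<Longrightarrow> v \<in> verts (T y) \<longleftrightarrow> v = root (T y) \<or> v \<in> edges (T y)"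
  using root_T by (auto simp: edges_def)

lemma is_rooted_tree_G: "is_rooted_tree G"
proof -
  have "finite (verts G)"
    unfolding verts_G using finite_C trees by (auto simp: is_rooted_tree_def)
  moreover have "parent G \<in> edges G \<rightarrow> verts G"
  proof
    fix a assume "a \<in> edges G"
    then obtain y v where "y \<in> C" "v \<in> verts (T y)" "a = emb y v"
      unfolding edges_G by blast
    then show "parent G a \<in> verts G"
      using parent_in_verts[OF trees, of y v] by (simp add: verts_G verts_T_iff) blast
  qed
  moreover have emb: "\<exists>k. (parent G ^^ k) (emb y v) = 0" if "y \<in> C" "v \<in> verts (T y)" for y v
    using trees[OF \<open>y \<in> C\<close>] \<open>v \<in> verts (T y)\<close>
  proof (induction rule: rooted_tree_induct)
    case root
    show ?case using \<open>y \<in> C\<close> by (auto intro: exI[of _ 1])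
  next
    case (edge v)
    then obtain k where "(parent G ^^ k) (emb y (parent (T y) v)) = 0" by blast
    then have "(parent G ^^ Suc k) (emb y v) = 0"
      using edge.hyps \<open>y \<in> C\<close> by (simp add: funpow_swap1 edges_def)
    then show ?case by blast
  qed
  moreover have "\<exists>k. (parent G ^^ k) 0 = 0"
    by (rule exI[of _ 0]) simp
  ultimately show ?thesis
    unfolding is_rooted_tree_def by (auto simp: verts_G)
qed

lemma children_G_0: "children G 0 = (\<lambda>y. emb y (root (T y))) ` C"
  unfolding children_def edges_G using root_T by (auto split: if_splits)

lemma children_G_emb:
  assumes "y \<in> C"
  shows "children G (emb y v) = emb y ` children (T y) v"
  unfolding children_def edges_G using assms by (auto simp: edges_def split: if_splits)

lemma leaves_G: "leaves G = (\<Union>y\<in>C. emb y ` leaves (T y))"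
proof -
  have "children G 0 \<noteq> {}" using children_G_0 y0 by blast
  then show ?thesis
    unfolding set_eq_iff leaf_iff verts_G by (auto simp: children_G_emb leaf_iff)
qed

lemma inner_verts_G: "inner_verts G = insert 0 (\<Union>y\<in>C. emb y ` inner_verts (T y))"
proof -
  have "children G 0 \<noteq> {}" using children_G_0 y0 by blast
  then show ?thesis
    unfolding set_eq_iff inner_vert_iff verts_G by (auto simp: children_G_emb inner_vert_iff)
qed

lemma ancestors_G_emb:
  assumes "y \<in> C" "v \<in> verts (T y)"
  shows "ancestors G (emb y v) = insert 0 (emb y ` ancestors (T y) v)"
  using trees[OF \<open>y \<in> C\<close>] \<open>v \<in> verts (T y)\<close>
proof (induction rule: rooted_tree_induct)
  case root
  have "ancestors G (emb y (root (T y))) = insert (emb y (root (T y))) (ancestors G (root G))"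
    using \<open>y \<in> C\<close> by (subst ancestors_step) simp_all
  also have "\<dots> = insert 0 (emb y ` ancestors (T y) (root (T y)))"
    unfolding ancestors_root by auto
  finally show ?case .
next
  case (edge v)
  then have v: "v \<noteq> root (T y)" by (simp add: edges_def)
  then have "ancestors G (emb y v) = insert (emb y v) (ancestors G (emb y (parent (T y) v)))"
    using \<open>y \<in> C\<close> by (subst ancestors_step) simp_all
  also have "\<dots> = insert 0 (emb y ` ancestors (T y) v)"
    unfolding edge.IH ancestors_step[OF v] by auto
  finally show ?case .
qed

lemma root_T_in_ancestors:
  assumes "y \<in> C" "v \<in> verts (T y)"
  shows "root (T y) \<in> ancestors (T y) v"
  using trees[OF \<open>y \<in> C\<close>] \<open>v \<in> verts (T y)\<close>
  by (induction rule: rooted_tree_induct) (auto simp: ancestors_self ancestors_step edges_def)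

lemma nonroot_ancestors_G_emb:
  assumes "y \<in> C" "v \<in> verts (T y)"
  shows "ancestors G (emb y v) - {root G} =
    insert (emb y (root (T y))) (emb y ` (ancestors (T y) v - {root (T y)}))"
  using ancestors_G_emb[OF assms] root_T_in_ancestors[OF assms] by auto

lemma card_ancestors_G_emb:
  assumes "y \<in> C" "v \<in> verts (T y)"
  shows "card (ancestors G (emb y v)) = Suc (card (ancestors (T y) v))"
  using ancestors_G_emb[OF assms] finite_ancestors[OF trees assms(2)] assms(1)
  by (simp add: card_image inj_emb image_iff)

lemma emb_in_edges0_G_iff:
  "y \<in> C \<Longrightarrow> emb y v \<in> edges0 G \<longleftrightarrow> y = y0 \<and> v = root (T y) \<or> v \<in> edges0 (T y)"
  using y0 by (auto simp: edges0_G)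

text \<open>Only the edge above the old root is new on the way to \<open>u\<close>, and it counts
  under the same condition as in the game.\<close>

lemma card_rank_set_G_emb:
  assumes "y \<in> C" "u \<in> verts (T y)" and edges0: "\<And>y. y \<in> C \<Longrightarrow> edges0 (T y) \<subseteq> edges (T y)"
  shows "card (rank_set G (emb y u)) =
    card (rank_set (T y) u) + of_bool (y \<noteq> y0 \<or> \<not> C \<subseteq> hlab (T y) u x)"
proof -
  have root: "root (T y) \<notin> edges0 (T y)"
    using edges0 assms(1) unfolding edges_def by blast
  let ?R = "if y \<noteq> y0 \<or> \<not> C \<subseteq> hlab (T y) u x then {emb y (root (T y))} else {}"
  have at_root: "(\<exists>b \<in> children G 0. ylab G b \<notin> hlab (T y) u x) \<longleftrightarrow> \<not> C \<subseteq> hlab (T y) u x"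
    by (auto simp: children_G_0)
  \<comment> \<open>Children inside \<open>T y\<close> are never its root, so they keep their labels
    in \<open>G\<close>.\<close>
  have above_root: "(\<exists>b \<in> children G (emb y v). ylab G b \<notin> B) \<longleftrightarrow>
      (\<exists>b \<in> children (T y) v. ylab (T y) b \<notin> B)" for v B
  proof -
    have "ylab G (emb y b) = ylab (T y) b" if "b \<in> children (T y) v" for b
      using that assms(1) by (simp add: children_def edges_def)
    then show ?thesis
      using assms(1) by (simp add: children_G_emb cong: bex_cong)
  qed
  define P where "P a \<longleftrightarrow> a \<notin> edges0 G \<or>
    (\<exists>b \<in> children G (parent G a). ylab G b \<notin> hlab G (emb y u) (xlab G (parent G a)))" for a
  have P_root: "P (emb y (root (T y))) \<longleftrightarrow> y \<noteq> y0 \<or> \<not> C \<subseteq> hlab (T y) u x"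
    unfolding P_def using assms(1) root by (simp add: at_root emb_in_edges0_G_iff)
  have P_emb: "P (emb y v) \<longleftrightarrow> v \<notin> edges0 (T y) \<or>
      (\<exists>b \<in> children (T y) (parent (T y) v). ylab (T y) b \<notin> hlab (T y) u (xlab (T y) (parent (T y) v)))"
    if "v \<noteq> root (T y)" for v
    unfolding P_def using assms(1) that by (simp add: above_root emb_in_edges0_G_iff)
  have "rank_set G (emb y u) = {a \<in> ancestors G (emb y u) - {root G}. P a}"
    unfolding rank_set_def P_def ..
  also have "\<dots> = ?R \<union> emb y ` {v \<in> ancestors (T y) u - {root (T y)}. P (emb y v)}"
    unfolding nonroot_ancestors_G_emb[OF assms(1,2)] P_root[symmetric] by auto
  also have "{v \<in> ancestors (T y) u - {root (T y)}. P (emb y v)} = rank_set (T y) u"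
    unfolding rank_set_def using P_emb by blast
  finally have "rank_set G (emb y u) = ?R \<union> emb y ` rank_set (T y) u" .
  moreover have "emb y (root (T y)) \<notin> emb y ` rank_set (T y) u"
    using assms(1) by (auto simp: rank_set_def)
  moreover have "finite (rank_set (T y) u)"
    using finite_ancestors[OF trees assms(2)] assms(1) by (simp add: rank_set_def)
  ultimately show ?thesis
    by (simp add: card_image inj_emb)
qed

text \<open>Everything inside a copy is inherited. At the new edge labelled \<open>y\<close>,
  shattering is exactly the restriction of the hypotheses of \<open>T y\<close> to those with
  \<open>y \<in> h x\<close>.\<close>

lemma ambiguous_shattered_G:
  assumes T: "\<And>y. y \<in> C \<Longrightarrow> ambiguous_shattered X Y {h \<in> S. y \<in> h x} (T y)"
    and "x \<in> X" "C \<subseteq> Y"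
  shows "ambiguous_shattered X Y S G"
  unfolding ambiguous_shattered_def
proof (intro conjI ballI impI)
  note T' = ambiguous_shatteredD[OF T]
  have root_notin_edges0: "root (T y) \<notin> edges0 (T y)" if "y \<in> C" for y
    using T'(5)[OF that] by (auto simp: edges_def)
  show "is_rooted_tree G" by (rule is_rooted_tree_G)
  show "xlab G \<in> inner_verts G \<rightarrow> X"
    using T'(2) \<open>x \<in> X\<close> by (auto simp: inner_verts_G)
  show "ylab G \<in> edges G \<rightarrow> Y"
    using T'(3) \<open>C \<subseteq> Y\<close> by (auto simp: edges_G verts_T_iff)
  show "hlab G \<in> leaves G \<rightarrow> S"
    using T'(4) by (auto simp: leaves_G)
  show "edges0 G \<subseteq> edges G"
    using T'(5) y0 by (fastforce simp: edges0_G edges_G verts_T_iff)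
  show "card (children G v \<inter> edges0 G) = 1" if v: "v \<in> inner_verts G" for v
  proof (cases "v = 0")
    case True
    have "children G 0 \<inter> edges0 G = {emb y0 (root (T y0))}"
      using T'(5) y0 root_notin_edges0 by (auto simp: children_G_0 edges0_G)
    then show ?thesis using True by simp
  next
    case False
    then obtain y w where w: "y \<in> C" "w \<in> inner_verts (T y)" "v = emb y w"
      using v by (auto simp: inner_verts_G)
    have "children G v \<inter> edges0 G = emb y ` (children (T y) w \<inter> edges0 (T y))"
      using w(1,3) by (auto simp: children_G_emb emb_in_edges0_G_iff root_notin_children)
    moreover have "card (children (T y) w \<inter> edges0 (T y)) = 1"
      using T'(6) w by blast
    ultimately show ?thesis by (simp add: card_image inj_emb)
  qed
  show "ylab G a \<noteq> ylab G b"
    if ab: "a \<in> edges G" "b \<in> edges G" "a \<noteq> b \<and> parent G a = parent G b" for a b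
  proof -
    obtain y v z w where a: "y \<in> C" "v \<in> verts (T y)" "a = emb y v"
      and b: "z \<in> C" "w \<in> verts (T z)" "b = emb z w"
      using ab unfolding edges_G by blast
    show ?thesis
    proof (cases "v = root (T y)")
      case True
      then show ?thesis using a b ab by (auto split: if_splits)
    next
      case False
      \<comment> \<open>The common parent is not 0, so it determines the branch.\<close>
      then have *: "y = z" "w \<noteq> root (T y)" "v \<noteq> w" "parent (T y) v = parent (T y) w"
        using a b ab by (auto split: if_splits)
      then have "v \<in> children (T y) (parent (T y) v)" "w \<in> children (T y) (parent (T y) v)"
        using a b False by (simp_all add: children_def edges_def)
      then have "ylab (T y) v \<noteq> ylab (T y) w"
        using inj_onD[OF T'(7)[OF a(1)]] \<open>v \<noteq> w\<close> by blast
      then show ?thesis using * a b False by simp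
    qed
  qed
  show "ylab G a \<in> hlab G u (xlab G (parent G a))"
    if u: "u \<in> leaves G" and a: "a \<in> ancestors G u - {root G}" for u a
  proof -
    obtain y v where v: "y \<in> C" "v \<in> leaves (T y)" "u = emb y v"
      using u unfolding leaves_G by blast
    from a consider "a = emb y (root (T y))"
      | b where "a = emb y b" "b \<in> ancestors (T y) v - {root (T y)}"
      unfolding v(3) nonroot_ancestors_G_emb[OF v(1) leaf_in_verts[OF v(2)]] by blast
    then show ?thesis
    proof cases
      case 1
      then show ?thesis using T'(4)[OF v(1,2)] v by simp
    next
      case 2
      then show ?thesis using T'(8)[OF v(1,2) 2(2)] v by simp
    qed
  qed
qed

end

lemma singleton_tree:
  assumes "h \<in> S"
  shows "\<exists>T :: (nat, 'x, 'y) hyp_tree. ambiguous_shattered X Y S T \<and>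
    leaves T = {root T} \<and> hlab T (root T) = h"
proof -
  define T :: "(nat, 'x, 'y) hyp_tree" where
    "T = \<lparr>verts = {0}, root = 0, parent = id, xlab = undefined, ylab = undefined,
      hlab = (\<lambda>_. h), edges0 = {}\<rparr>"
  have "edges T = {}" by (simp add: T_def edges_def)
  then have "leaves T = {0}" "inner_verts T = {}"
    by (simp_all add: leaves_def inner_verts_def T_def)
  moreover have "is_rooted_tree T"
    unfolding is_rooted_tree_def by (simp add: \<open>edges T = {}\<close>) (simp add: T_def)
  moreover have "ancestors T 0 = {0}"
    using ancestors_root[of T] by (simp add: T_def)
  ultimately have "ambiguous_shattered X Y S T"
    unfolding ambiguous_shattered_def using \<open>edges T = {}\<close> assms by (simp add: T_def)
  then show ?thesis
    using \<open>leaves T = {0}\<close> by (intro exI[of _ T]) (simp add: T_def)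
qed

text \<open>The term \<open>w (hlab T u)\<close> accounts for edges above the current position, so a
  child can pass the charge of its edge on to the glued tree. \<open>Suc D\<close> appears because
  \<open>ancestors\<close> counts vertices while \<open>D\<close> counts edges.\<close>

lemma tree_of_win:
  fixes S :: "('x \<Rightarrow> 'y set) set"
  assumes "win X Y N S w D"
  shows "\<exists>T :: (nat, 'x, 'y) hyp_tree. ambiguous_shattered X Y S T \<and>
    (\<forall>u \<in> leaves T. N \<le> w (hlab T u) + card (rank_set T u) \<and> card (ancestors T u) \<le> Suc D)"
  using assms
proof induction
  case (leaf h S w D)
  obtain T :: "(nat, 'x, 'y) hyp_tree" where "ambiguous_shattered X Y S T"
      "leaves T = {root T}" "hlab T (root T) = h"
    using singleton_tree[OF leaf(1)] by blast
  then show ?case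
    using leaf(2) by (intro exI[of _ T]) (simp add: ancestors_root)
next
  case (node x C y0 S w D)
  then have "\<forall>y\<in>C. \<exists>T :: (nat, 'x, 'y) hyp_tree.
      ambiguous_shattered X Y {h \<in> S. y \<in> h x} T \<and>
      (\<forall>u \<in> leaves T. N \<le> w (hlab T u) + of_bool (y \<noteq> y0 \<or> \<not> C \<subseteq> hlab T u x)
        + card (rank_set T u) \<and> card (ancestors T u) \<le> Suc D)"
    by simp
  from bchoice[OF this] obtain T :: "'y \<Rightarrow> (nat, 'x, 'y) hyp_tree" where
    T: "\<And>y. y \<in> C \<Longrightarrow> ambiguous_shattered X Y {h \<in> S. y \<in> h x} (T y)" and
    T_leaf: "\<And>y u. y \<in> C \<Longrightarrow> u \<in> leaves (T y) \<Longrightarrow>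
      N \<le> w (hlab (T y) u) + of_bool (y \<noteq> y0 \<or> \<not> C \<subseteq> hlab (T y) u x)
        + card (rank_set (T y) u) \<and> card (ancestors (T y) u) \<le> Suc D"
    by blast
  \<comment> \<open>The labels in the finite set \<open>C\<close> are coded by numbers, which keeps
    the vertex type \<open>nat\<close> at every stage of the induction.\<close>
  obtain code :: "'y \<Rightarrow> nat" where "inj_on code C"
    using finite_imp_inj_to_nat_seg[OF \<open>finite C\<close>] by metis
  then interpret glue code x C y0 T
    using node.hyps ambiguous_shatteredD(1)[OF T] by unfold_locales auto
  have "ambiguous_shattered X Y S G"
    using ambiguous_shattered_G[OF T] node.hyps by blast
  moreover have "N \<le> w (hlab G u) + card (rank_set G u) \<and> card (ancestors G u) \<le> Suc (Suc D)"
    if u: "u \<in> leaves G" for u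
  proof -
    obtain y v where v: "y \<in> C" "v \<in> leaves (T y)" "u = emb y v"
      using u unfolding leaves_G by blast
    show ?thesis
      \<comment> \<open>The \<open>of_bool\<close> term in \<open>T_leaf\<close> reappears as the
        rank gained by the new edge, and the new root is the one extra ancestor.\<close>
      using v leaf_in_verts[OF v(2)] ambiguous_shatteredD(5)[OF T] T_leaf[OF v(1,2)]
      by (simp add: card_rank_set_G_emb card_ancestors_G_emb add_ac)
  qed
  ultimately show ?case by blast
qed

theorem theorem4p2:
  fixes X :: "'x set" and Y :: "'y set" and H :: "('x \<Rightarrow> 'y set) set" and N :: nat
  assumes "finite Y"
    and "H \<noteq> {}"
    and "H \<subseteq> X \<rightarrow>\<^sub>E Pow Y"
    and "\<forall>h \<in> H. \<exists>x \<in> X. h x \<noteq> {}"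
    and "\<exists>T :: ('v, 'x, 'y) hyp_tree. ambiguous_shattered X Y H T \<and> rank T \<ge> N\<^sup>2"
  shows "\<exists>T' :: (nat, 'x, 'y) hyp_tree.
    ambiguous_shattered X Y H T' \<and> rank T' \<ge> N \<and> depth T' \<le> N\<^sup>2"
proof -
  \<comment> \<open>The game does not mention vertices, so passing through it also changes the
    vertex type from \<open>'v\<close> to \<open>nat\<close>.\<close>
  obtain D where "win X Y (N\<^sup>2) H (\<lambda>h. 0) D"
    using assms(5) win_of_tree by blast
  then obtain T :: "(nat, 'x, 'y) hyp_tree" where T: "ambiguous_shattered X Y H T"
      "\<forall>u \<in> leaves T. N \<le> card (rank_set T u) \<and> card (ancestors T u) \<le> Suc (N\<^sup>2)"
    using tree_of_win[OF win_compress] by force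
  with ambiguous_shatteredD(1)[OF T(1)] show ?thesis
    using rank_ge_iff depth_le_iff by blast
qed

end
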